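(* Let $\Phi(\xi)\in\mathbb{C}[\xi]$ be a polynomial in one variable and let $\Lambda=\partial_x-\Phi(\partial_y)$, a differential operator on $\mathbb{C}[x,y]$. Let $P(x,y)\in\mathbb{C}[x,y]$ be a polynomial such that $\Lambda^m(P^m)=0$ for every $m\ge 1$. Then for every $g(x,y)\in\mathbb{C}[x,y]$ there exists $N\ge 1$ such that $\Lambda^m(P^m g)=0$ for all $m\ge N$.
   Context: Here $x,y$ are commuting variables, $\partial_x=\partial/\partial x$, $\partial_y=\partial/\partial y$, and $\Phi(\partial_y)$ is obtained by substituting $\partial_y$ for $\xi$ in $\Phi(\xi)$. $\Lambda^m$ is the $m$-fold composition of $\Lambda$ and $P^m$ is the $m$-th power of $P$. *)

theory Defs
  imports Complex_Main "HOL-Computational_Algebra.Polynomial"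
begin

text \<open>
  The ring \<open>\<complex>[x,y]\<close> is represented as \<open>\<complex>[x][y]\<close>: the outer variable of a
  \<^typ>\<open>complex poly poly\<close> is \<open>y\<close>, and the coefficients are polynomials in \<open>x\<close>.
\<close>

type_synonym cpoly_xy = "complex poly poly"

definition partial_x :: "cpoly_xy \<Rightarrow> cpoly_xy" where
  "partial_x f = map_poly pderiv f"

definition partial_y :: "cpoly_xy \<Rightarrow> cpoly_xy" where
  "partial_y f = pderiv f"

definition subst_partial_y :: "complex poly \<Rightarrow> cpoly_xy \<Rightarrow> cpoly_xy" where
  "subst_partial_y \<Phi> f = (\<Sum>i\<le>degree \<Phi>. smult [:coeff \<Phi> i:] ((partial_y ^^ i) f))"

definition Lambda_op :: "complex poly \<Rightarrow> cpoly_xy \<Rightarrow> cpoly_xy" where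
  "Lambda_op \<Phi> f = partial_x f - subst_partial_y \<Phi> f"

end

theory Submission
  imports Defs "HOL-Computational_Algebra.Formal_Power_Series" "HOL-Computational_Algebra.Primes"
begin

text \<open>
  Write \<open>\<Phi> = c\<^sub>0 + c \<xi> + \<xi>\<^sup>2 \<Phi>\<^sub>2\<close>. If \<open>c\<^sub>0 \<noteq> 0\<close>, then \<open>\<Lambda>\<close> is injective and \<open>P = 0\<close>.
  Otherwise \<open>\<Lambda> = a + d\<close>, where \<open>d = \<partial>\<^sub>x - c \<partial>\<^sub>y\<close> is a derivation and
  \<open>a = - \<Phi>\<^sub>2(\<partial>\<^sub>y) \<partial>\<^sub>y\<^sup>2\<close>. Let \<open>A\<close> be the subring of \<open>\<complex>\<close> generated by all coefficients. For a
  prime \<open>q\<close> the operator \<open>\<Lambda>\<^sup>q/q!\<close> preserves \<open>A[x,y]\<close>, and modulo \<open>q\<close> it sends \<open>P\<^sup>q\<close> to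
  \<open>(d P)\<^sup>q\<close>. So \<open>(d P)\<^sup>q\<close> lies in \<open>q A[x,y]\<close> for every prime \<open>q\<close>. In a finitely generated
  subring of \<open>\<complex>\<close> a nonzero element is nilpotent modulo only finitely many primes, whence
  \<open>d P = 0\<close>. Now \<open>\<Lambda> P = 0\<close> gives \<open>a P = 0\<close>, so the degree of \<open>P\<close> in \<open>y\<close> is below the order
  of \<open>a\<close>. Since powers of \<open>d\<close> pass through \<open>P\<^sup>m\<close> and eventually kill \<open>g\<close>, almost all of the \<open>m\<close>
  factors of a surviving term of \<open>\<Lambda>\<^sup>m(P\<^sup>m g)\<close> would be \<open>a\<close>, which is impossible for degree reasons.
\<close>

section \<open>Subrings and primes\<close>

definition subring_set :: "'a::comm_ring_1 set \<Rightarrow> bool" where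
  "subring_set A \<longleftrightarrow> 1 \<in> A \<and> (\<forall>x\<in>A. \<forall>y\<in>A. x - y \<in> A \<and> x * y \<in> A)"

lemma
  assumes "subring_set A"
  shows subring_one: "1 \<in> A"
    and subring_diff: "x \<in> A \<Longrightarrow> y \<in> A \<Longrightarrow> x - y \<in> A"
    and subring_mult: "x \<in> A \<Longrightarrow> y \<in> A \<Longrightarrow> x * y \<in> A"
    and subring_zero: "0 \<in> A"
    and subring_uminus: "x \<in> A \<Longrightarrow> - x \<in> A"
    and subring_add: "x \<in> A \<Longrightarrow> y \<in> A \<Longrightarrow> x + y \<in> A"
proof -
  show 1: "1 \<in> A" and d: "x \<in> A \<Longrightarrow> y \<in> A \<Longrightarrow> x - y \<in> A"
    and "x \<in> A \<Longrightarrow> y \<in> A \<Longrightarrow> x * y \<in> A" for x y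
    using assms by (auto simp: subring_set_def)
  show 0: "0 \<in> A" using d[OF 1 1] by simp
  show m: "x \<in> A \<Longrightarrow> - x \<in> A" for x using d[OF 0, of x] by simp
  show "x \<in> A \<Longrightarrow> y \<in> A \<Longrightarrow> x + y \<in> A" using d[OF _ m, of x y] by simp
qed

lemma subring_sum:
  assumes "subring_set A" "\<And>i. i \<in> I \<Longrightarrow> f i \<in> A"
  shows "sum f I \<in> A"
  using assms(2)
  by (induction I rule: infinite_finite_induct)
    (auto intro: subring_zero[OF assms(1)] subring_add[OF assms(1)])

lemma subring_power: "subring_set A \<Longrightarrow> x \<in> A \<Longrightarrow> x ^ n \<in> A"
  by (induction n) (auto intro: subring_one subring_mult)

lemma subring_of_nat: "subring_set A \<Longrightarrow> of_nat n \<in> A"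
  by (induction n) (auto intro: subring_zero subring_one subring_add)

section \<open>Polynomials over a subring and pseudo-division\<close>

definition polys_over :: "'a::comm_ring_1 set \<Rightarrow> 'a poly set" where
  "polys_over A = {p. \<forall>i. coeff p i \<in> A}"

lemma polys_overI: "(\<And>i. coeff p i \<in> A) \<Longrightarrow> p \<in> polys_over A"
  and polys_overD: "p \<in> polys_over A \<Longrightarrow> coeff p i \<in> A"
  by (auto simp: polys_over_def)

lemma subring_polys_over:
  assumes A: "subring_set A" shows "subring_set (polys_over A)"
  unfolding subring_set_def
  by (auto simp: polys_over_def coeff_mult intro!: subring_sum[OF A] subring_one[OF A]
      subring_zero[OF A] subring_diff[OF A] subring_mult[OF A])

lemma pCons_polys_over:
  "subring_set A \<Longrightarrow> pCons c p \<in> polys_over A \<longleftrightarrow> c \<in> A \<and> p \<in> polys_over A"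
  unfolding polys_over_def mem_Collect_eq by (metis coeff_pCons_0 coeff_pCons_Suc not0_implies_Suc)

lemma smult_polys_over:
  "subring_set A \<Longrightarrow> c \<in> A \<Longrightarrow> p \<in> polys_over A \<Longrightarrow> smult c p \<in> polys_over A"
  by (auto simp: polys_over_def intro: subring_mult)

lemma monom_polys_over: "subring_set A \<Longrightarrow> c \<in> A \<Longrightarrow> monom c n \<in> polys_over A"
  by (auto simp: polys_over_def intro: subring_zero)

text \<open>Pseudo-division never divides: each round only scales by \<open>lc\<close> and adds or
  subtracts terms built from a monomial and \<open>d\<close>, so all coefficients stay in
  \<open>A\<close>.\<close>

lemma pseudo_divmod_main_polys_over:
  assumes A: "subring_set A" and "lc \<in> A" "d \<in> polys_over A"
    and "q \<in> polys_over A" "r \<in> polys_over A"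
    and "pseudo_divmod_main lc q r d dr n = (q', r')"
  shows "q' \<in> polys_over A \<and> r' \<in> polys_over A"
  using assms(4-6)
proof (induction n arbitrary: q r dr)
  case (Suc n)
  note R = subring_polys_over[OF A]
  have m: "monom (coeff r dr) n \<in> polys_over A"
    by (rule monom_polys_over[OF A polys_overD[OF Suc.prems(2)]])
  show ?case
    by (rule Suc.IH[OF _ _ Suc.prems(3)[simplified pseudo_divmod_main.simps Let_def]])
      (intro subring_add[OF R] subring_diff[OF R] subring_mult[OF R]
         smult_polys_over[OF A] m assms Suc.prems)+
qed auto

lemma pseudo_division_over:
  fixes f g :: "'a::idom poly"
  assumes A: "subring_set A" and f: "f \<in> polys_over A" and g: "g \<in> polys_over A" "g \<noteq> 0"
  obtains k h r where "h \<in> polys_over A" "r \<in> polys_over A"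
    "smult (lead_coeff g ^ k) f = g * h + r" "r = 0 \<or> degree r < degree g"
proof -
  obtain h r where hr: "pseudo_divmod f g = (h, r)" by force
  have "h \<in> polys_over A \<and> r \<in> polys_over A"
    by (rule pseudo_divmod_main_polys_over[OF A polys_overD[OF g(1)] g(1) _ f
          hr[unfolded pseudo_divmod_def, simplified g if_False]])
      (rule subring_zero[OF subring_polys_over[OF A]])
  then show ?thesis using pseudo_divmod[OF g(2) hr] that by blast
qed

section \<open>Finitely generated subrings and nilpotence modulo primes\<close>

definition adjoin :: "'a::comm_ring_1 set \<Rightarrow> 'a \<Rightarrow> 'a set" where
  "adjoin A s = (\<lambda>f. poly f s) ` polys_over A"

lemma subring_adjoin:
  assumes "subring_set A" shows "subring_set (adjoin A s)"
proof -
  note R = subring_polys_over[OF assms]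
  show ?thesis unfolding subring_set_def adjoin_def
  proof (intro conjI ballI)
    show "1 \<in> (\<lambda>f. poly f s) ` polys_over A"
      by (rule image_eqI[OF _ subring_one[OF R]]) simp
  next
    fix x y assume "x \<in> (\<lambda>f. poly f s) ` polys_over A" "y \<in> (\<lambda>f. poly f s) ` polys_over A"
    then obtain f g where "x = poly f s" "y = poly g s" "f \<in> polys_over A" "g \<in> polys_over A"
      by auto
    then show "x - y \<in> (\<lambda>f. poly f s) ` polys_over A" "x * y \<in> (\<lambda>f. poly f s) ` polys_over A"
      using imageI[OF subring_diff[OF R], of f g "\<lambda>f. poly f s"]
        imageI[OF subring_mult[OF R], of f g "\<lambda>f. poly f s"] by simp_all
  qed
qed

lemma subset_adjoin: "subring_set A \<Longrightarrow> A \<subseteq> adjoin A s"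
  by (auto simp: adjoin_def pCons_polys_over intro!: image_eqI[of _ _ "[:_:]"]
      subring_zero[OF subring_polys_over])

lemma mem_adjoin: "subring_set A \<Longrightarrow> s \<in> adjoin A s"
  by (auto simp: adjoin_def pCons_polys_over intro!: image_eqI[of _ _ "[:0, 1:]"]
      subring_zero subring_one subring_polys_over)

text \<open>Generators are adjoined one at a time, so that properties pass along simple extensions
  by induction, whether \<open>s\<close> is algebraic or transcendental over
  \<open>A\<close>.\<close>

inductive fg_ring :: "complex set \<Rightarrow> bool" where
  Ints: "fg_ring \<int>"
| adjoin: "fg_ring A \<Longrightarrow> fg_ring (adjoin A s)"

lemma subring_fg_ring: "fg_ring A \<Longrightarrow> subring_set A"
  by (induction rule: fg_ring.induct) (auto simp: subring_set_def[of \<int>] subring_adjoin)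

lemma fg_ring_superset:
  assumes "finite S" shows "\<exists>A. fg_ring A \<and> S \<subseteq> A"
  using assms
proof (induction S rule: finite_induct)
  case empty
  then show ?case using Ints by blast
next
  case (insert s S)
  then obtain A where "fg_ring A" "S \<subseteq> A" by blast
  then show ?case
    using subset_adjoin[OF subring_fg_ring, of A s] mem_adjoin[OF subring_fg_ring, of A s]
    by (intro exI[of _ "adjoin A s"]) (auto intro: fg_ring.adjoin)
qed

text \<open>For large primes \<open>q\<close> the element \<open>a\<close> is not nilpotent in
  \<open>A / q A\<close>. The bound \<open>N\<close> depends on \<open>a\<close> but not on
  \<open>n\<close>, which later permits \<open>n = q\<close>.\<close>

definition regular_at_primes :: "complex set \<Rightarrow> bool" where
  "regular_at_primes A \<longleftrightarrow> (\<forall>a\<in>A. a \<noteq> 0 \<longrightarrow>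
     (\<exists>N. \<forall>q>N. prime (q::nat) \<longrightarrow> (\<forall>n. \<forall>z\<in>A. a ^ n \<noteq> of_nat q * z)))"

text \<open>A prime dividing a power of a nonzero integer \<open>k\<close> divides \<open>k\<close>,
  so it cannot exceed the absolute value of \<open>k\<close>.\<close>

lemma regular_at_primes_Ints: "regular_at_primes \<int>"
  unfolding regular_at_primes_def
proof (intro ballI impI)
  fix a :: complex assume "a \<in> \<int>" "a \<noteq> 0"
  then obtain k where k: "a = of_int k" "k \<noteq> 0" by (auto elim: Ints_cases)
  show "\<exists>N. \<forall>q>N. prime (q::nat) \<longrightarrow> (\<forall>n. \<forall>z\<in>\<int>. a ^ n \<noteq> of_nat q * z)"
  proof (intro exI[of _ "nat \<bar>k\<bar>"] allI impI ballI notI)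
    fix q n :: nat and z :: complex
    assume q: "nat \<bar>k\<bar> < q" "prime q" and "z \<in> \<int>" and eq: "a ^ n = of_nat q * z"
    then obtain l where l: "z = of_int l" by (auto elim: Ints_cases)
    have "of_int (k ^ n) = (of_int (int q * l) :: complex)"
      using eq k l by simp
    then have "k ^ n = int q * l" by (simp only: of_int_eq_iff)
    then have "int q dvd k" using q(2) prime_dvd_power[of "int q" k n] by auto
    then show False using k q(1) zdvd_imp_le[of "int q" "\<bar>k\<bar>"] by auto
  qed
qed

text \<open>A nonzero \<open>f(s)\<close> has a nonzero multiple in \<open>A\<close>: the polynomial \<open>g\<close> of least degree with
  \<open>g(s)\<close> a nonzero multiple of \<open>f(s)\<close> is constant, for otherwise dividing the minimal polynomial
  \<open>m\<close> by \<open>g\<close> would lower its degree.\<close>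

lemma algebraic_multiple_in_base:
  fixes A :: "'a::idom set"
  assumes A: "subring_set A" and m: "m \<in> polys_over A" "m \<noteq> 0" "poly m s = 0"
    and min: "\<And>p. p \<in> polys_over A \<Longrightarrow> p \<noteq> 0 \<Longrightarrow> poly p s = 0 \<Longrightarrow> degree m \<le> degree p"
    and f: "f \<in> polys_over A" "poly f s \<noteq> 0"
  obtains b u where "b \<in> A" "b \<noteq> 0" "u \<in> polys_over A" "b = poly f s * poly u s"
proof -
  note R = subring_polys_over[OF A]
  define G where "G g \<longleftrightarrow> g \<in> polys_over A \<and> poly g s \<noteq> 0 \<and>
    (\<exists>u\<in>polys_over A. poly g s = poly f s * poly u s)" for g
  have "G f" using f by (auto simp: G_def intro!: bexI[of _ 1] subring_one[OF R])
  then obtain g where g: "G g" and gmin: "\<And>h. G h \<Longrightarrow> degree g \<le> degree h"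
    using exists_least_iff[of "\<lambda>n. \<exists>g. G g \<and> degree g = n"]
    by (metis not_le_imp_less)
  from g obtain u where gA: "g \<in> polys_over A" and g0: "poly g s \<noteq> 0"
    and u: "u \<in> polys_over A" "poly g s = poly f s * poly u s" by (auto simp: G_def)
  have gn0: "g \<noteq> 0" using g0 by auto
  \<comment> \<open>Pseudo-dividing \<open>g\<close> by \<open>m\<close> leaves a remainder whose
    value at \<open>s\<close> is still a nonzero multiple of \<open>poly f s\<close>; minimality of
    \<open>g\<close> bounds its degree by that of this remainder.\<close>
  have small: "degree g < degree m"
  proof -
    obtain k h r where h: "h \<in> polys_over A" and r: "r \<in> polys_over A"
      and eq: "smult (lead_coeff m ^ k) g = m * h + r" and dr: "r = 0 \<or> degree r < degree m"
      using pseudo_division_over[OF A gA m(1,2)] by metis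
    have rs: "poly r s = lead_coeff m ^ k * poly g s"
      using arg_cong[OF eq, of "\<lambda>p. poly p s"] m by simp
    have "poly r s \<noteq> 0" using rs g0 m by simp
    moreover from this have "G r" unfolding G_def
      using r u rs
      by (auto intro!: bexI[of _ "smult (lead_coeff m ^ k) u"]
          smult_polys_over[OF A] subring_power[OF A] polys_overD[OF m(1)])
    ultimately show ?thesis using gmin[of r] dr by auto
  qed
  obtain k h r where h: "h \<in> polys_over A" and r: "r \<in> polys_over A"
    and eq: "smult (lead_coeff g ^ k) m = g * h + r" and dr: "r = 0 \<or> degree r < degree g"
    using pseudo_division_over[OF A m(1) gA gn0] by metis
  have "poly (g * h + r) s = 0" by (simp flip: eq add: m)
  then have rs: "poly r s = - (poly g s * poly h s)" by (simp add: eq_neg_iff_add_eq_0 add.commute)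
  have "degree g = 0"
  proof (cases "poly r s = 0")
    case False
    have "G r" unfolding G_def
      using False r rs u h
      by (auto intro!: bexI[of _ "- (u * h)"] subring_uminus[OF R] subring_mult[OF R])
    then have "degree g \<le> degree r" by (rule gmin)
    with dr False show ?thesis by auto
  next
    case True
    \<comment> \<open>Now \<open>r\<close> has root \<open>s\<close> and degree below
      \<open>m\<close>, so it is 0. As \<open>h\<close> also has root \<open>s\<close>, its degree
      is at least that of \<open>m\<close>, which leaves degree 0 for \<open>g\<close>.\<close>
    then have hs: "poly h s = 0" using rs g0 by simp
    have "r = 0"
    proof (rule ccontr)
      assume "r \<noteq> 0"
      then show False using min[OF r _ True] dr small by linarith
    qed
    then have eq: "smult (lead_coeff g ^ k) m = g * h" using eq by simp
    then have "h \<noteq> 0" using m gn0 by auto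
    then have "degree m \<le> degree h" "degree m = degree g + degree h"
      using min[OF h _ hs] arg_cong[OF eq, of degree] gn0 by (auto simp: degree_mult_eq)
    then show ?thesis by simp
  qed
  then obtain b where b: "g = [:b:]" by (rule degree_eq_zeroE)
  show ?thesis
    by (rule that[of b u]) (use b g0 u polys_overD[OF gA, of 0] in auto)
qed

text \<open>If \<open>s\<close> is transcendental, \<open>a ^ n = of_nat q * z\<close> lifts to
  polynomials and leading coefficients are compared. If \<open>s\<close> is algebraic, a nonzero
  multiple of \<open>a\<close> in \<open>A\<close> carries the identity down to
  \<open>A\<close>.\<close>

lemma regular_at_primes_adjoin:
  assumes A: "subring_set A" and reg: "regular_at_primes A"
  shows "regular_at_primes (adjoin A s)"
  unfolding regular_at_primes_def
proof (intro ballI impI)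
  note R = subring_polys_over[OF A]
  fix a assume "a \<in> adjoin A s" and a0: "a \<noteq> 0"
  then obtain f where f: "f \<in> polys_over A" "a = poly f s" by (auto simp: adjoin_def)
  show "\<exists>N. \<forall>q>N. prime (q::nat) \<longrightarrow> (\<forall>n. \<forall>z\<in>adjoin A s. a ^ n \<noteq> of_nat q * z)"
  proof (cases "\<exists>p\<in>polys_over A. p \<noteq> 0 \<and> poly p s = 0")
    case False
    have "lead_coeff f \<in> A" "lead_coeff f \<noteq> 0" using f a0 by (auto simp: polys_overD)
    then obtain N where N: "\<And>q n z. q > N \<Longrightarrow> prime (q::nat) \<Longrightarrow> z \<in> A \<Longrightarrow>
        lead_coeff f ^ n \<noteq> of_nat q * z"
      using reg unfolding regular_at_primes_def by metis
    have "a ^ n \<noteq> of_nat q * z" if q: "q > N" "prime q" and z: "z \<in> adjoin A s" for q n z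
    proof
      assume eq: "a ^ n = of_nat q * z"
      obtain h where h: "h \<in> polys_over A" "z = poly h s" using z by (auto simp: adjoin_def)
      have "f ^ n - smult (of_nat q) h \<in> polys_over A"
        using f h by (intro subring_diff[OF R] subring_power[OF R] smult_polys_over[OF A]
            subring_of_nat[OF A])
      moreover have "poly (f ^ n - smult (of_nat q) h) s = 0"
        using eq f h by simp
      ultimately have "f ^ n = smult (of_nat q) h" using False by auto
      then have "lead_coeff f ^ n = of_nat q * coeff h (degree (f ^ n))"
        by (metis coeff_smult lead_coeff_power)
      then show False using N q h by (auto simp: polys_overD)
    qed
    then show ?thesis by blast
  next
    case True
    define M where "M p \<longleftrightarrow> p \<in> polys_over A \<and> p \<noteq> 0 \<and> poly p s = 0" for p
    obtain m where m: "M m" and mmin: "\<And>p. M p \<Longrightarrow> degree m \<le> degree p"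
      using True exists_least_iff[of "\<lambda>n. \<exists>p. M p \<and> degree p = n"] unfolding M_def[symmetric]
      by (metis M_def not_le_imp_less)
    note mA = m[unfolded M_def, THEN conjunct1] m[unfolded M_def, THEN conjunct2, THEN conjunct1]
      m[unfolded M_def, THEN conjunct2, THEN conjunct2]
    obtain b u where b: "b \<in> A" "b \<noteq> 0" and u: "u \<in> polys_over A" "b = a * poly u s"
      using algebraic_multiple_in_base[OF A mA mmin f(1)] f a0 unfolding M_def by metis
    define c where "c = lead_coeff m"
    have c: "c \<in> A" "c \<noteq> 0" using mA by (auto simp: c_def polys_overD)
    have dm: "degree m > 0" by (rule gr0I) (use mA in \<open>auto elim!: degree_eq_zeroE\<close>)
    \<comment> \<open>Reduction modulo \<open>m\<close> will cost powers of its leading coefficient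
      \<open>c\<close>, so \<open>N\<close> is chosen for \<open>c * b\<close> rather than for
      \<open>b\<close>.\<close>
    obtain N where N: "\<And>q n z. q > N \<Longrightarrow> prime (q::nat) \<Longrightarrow> z \<in> A \<Longrightarrow> (c * b) ^ n \<noteq> of_nat q * z"
      using reg b c subring_mult[OF A c(1) b(1)] unfolding regular_at_primes_def
      by (metis mult_eq_0_iff)
    have "a ^ n \<noteq> of_nat q * z" if q: "q > N" "prime q" and z: "z \<in> adjoin A s" for q n z
    proof
      assume eq: "a ^ n = of_nat q * z"
      obtain h where h: "h \<in> polys_over A" "z = poly h s" using z by (auto simp: adjoin_def)
      \<comment> \<open>From \<open>b = a * poly u s\<close> one gets
        \<open>b ^ n = of_nat q * (z * poly u s ^ n)\<close>. The factor in parentheses is the value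
        of \<open>h * u ^ n\<close> at \<open>s\<close>, which is reduced modulo
        \<open>m\<close>.\<close>
      have "h * u ^ n \<in> polys_over A"
        using h u by (intro subring_mult[OF R] subring_power[OF R])
      then obtain k w r where r: "r \<in> polys_over A"
        and eq2: "smult (c ^ k) (h * u ^ n) = m * w + r" and dr: "r = 0 \<or> degree r < degree m"
        unfolding c_def using pseudo_division_over[OF A _ mA(1,2)] by metis
      have "poly r s = c ^ k * (z * poly u s ^ n)"
        using arg_cong[OF eq2, of "\<lambda>p. poly p s"] mA h by simp
      then have "c ^ k * b ^ n = of_nat q * poly r s"
        by (simp add: u power_mult_distrib eq)
      \<comment> \<open>This polynomial has root \<open>s\<close> and degree below that of
        \<open>m\<close>, so it is 0; its constant coefficient is an identity inside
        \<open>A\<close>.\<close>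
      then have root: "poly ([:c ^ k * b ^ n:] - smult (of_nat q) r) s = 0" by simp
      have "[:c ^ k * b ^ n:] - smult (of_nat q) r \<in> polys_over A"
        using b c r by (intro subring_diff[OF R] smult_polys_over[OF A])
          (auto simp: pCons_polys_over[OF A] intro: subring_of_nat[OF A] subring_zero[OF R]
            subring_mult[OF A] subring_power[OF A])
      moreover have "degree ([:c ^ k * b ^ n:] - smult (of_nat q) r) < degree m"
        using dr dm by (intro degree_diff_less) auto
      ultimately have "[:c ^ k * b ^ n:] - smult (of_nat q) r = 0"
        using root mmin unfolding M_def by (meson not_le)
      then have "coeff ([:c ^ k * b ^ n:] - smult (of_nat q) r) 0 = 0" by simp
      then have eq3: "c ^ k * b ^ n = of_nat q * coeff r 0" by simp
      \<comment> \<open>The exponent \<open>k\<close> from pseudo-division is uncontrolled, so both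
        exponents are raised to \<open>k + n\<close>.\<close>
      have "(c * b) ^ (k + n) = c ^ n * b ^ k * (c ^ k * b ^ n)"
        by (simp add: power_add power_mult_distrib)
      also have "\<dots> = of_nat q * (c ^ n * b ^ k * coeff r 0)" by (simp add: eq3)
      finally show False
        using N[OF q, of "c ^ n * b ^ k * coeff r 0" "k + n"] b c r
        by (simp add: subring_mult[OF A] subring_power[OF A] polys_overD)
    qed
    then show ?thesis by blast
  qed
qed

lemma regular_at_primes_fg_ring: "fg_ring A \<Longrightarrow> regular_at_primes A"
  by (induction rule: fg_ring.induct)
    (auto intro: regular_at_primes_Ints regular_at_primes_adjoin subring_fg_ring)


section \<open>Divided powers of operators\<close>

unbundle fps_syntax

text \<open>Only complex scalars \<open>[:c:]\<close> are pulled out; linearity over \<complex>[x]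
  would exclude \<open>partial_x\<close>.\<close>

definition op_linear :: "(cpoly_xy \<Rightarrow> cpoly_xy) \<Rightarrow> bool" where
  "op_linear L \<longleftrightarrow> (\<forall>f g. L (f + g) = L f + L g) \<and> (\<forall>c f. L (smult [:c:] f) = smult [:c:] (L f))"

lemma
  assumes "op_linear L"
  shows op_add: "L (f + g) = L f + L g"
    and op_smult: "L (smult [:c:] f) = smult [:c:] (L f)"
    and op_zero: "L 0 = 0"
    and op_of_nat: "L (of_nat n * f) = of_nat n * L f"
proof -
  show a: "L (f + g) = L f + L g" and s: "L (smult [:c:] f) = smult [:c:] (L f)" for f g c
    using assms by (auto simp: op_linear_def)
  show z: "L 0 = 0" using s[of 0 0] by simp
  show "L (of_nat n * f) = of_nat n * L f"
    by (induction n) (simp_all add: z a algebra_simps)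
qed

lemma op_linear_funpow: "op_linear L \<Longrightarrow> op_linear (L ^^ n)"
  by (induction n) (auto simp: op_linear_def)

lemma funpow_commute_op: "(\<And>f. L (M f) = M (L f)) \<Longrightarrow> (L ^^ n) (M f) = M ((L ^^ n) f)"
  by (induction n) auto

text \<open>Dividing by n! removes the binomial coefficients from the sum and product formulas and
  makes divisibility by primes visible.\<close>

definition dpow :: "(cpoly_xy \<Rightarrow> cpoly_xy) \<Rightarrow> nat \<Rightarrow> cpoly_xy \<Rightarrow> cpoly_xy" where
  "dpow L n f = smult [:1 / fact n:] ((L ^^ n) f)"

lemma dpow_0 [simp]: "dpow L 0 f = f"
  by (simp add: dpow_def flip: one_pCons)

lemma op_linear_dpow: "op_linear L \<Longrightarrow> op_linear (dpow L n)"
  using op_linear_funpow[of L n]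
  by (auto simp: op_linear_def dpow_def smult_add_right mult.commute)

lemma of_nat_mult_poly_xy: "of_nat n * (f :: cpoly_xy) = smult [:of_nat n:] f"
  by (simp add: of_nat_poly)

lemma dpow_Suc: "dpow L n (L f) = of_nat (Suc n) * dpow L (Suc n) f"
  by (simp add: dpow_def of_nat_mult_poly_xy funpow_swap1 field_simps del: of_nat_Suc)

lemma funpow_eq_dpow: "(L ^^ n) f = of_nat (fact n) * dpow L n f"
  unfolding dpow_def of_nat_mult_poly_xy by (simp flip: one_pCons)

lemma dpow_1 [simp]: "dpow L (Suc 0) f = L f"
  by (simp add: dpow_def flip: one_pCons)

lemma dpow_eq_0_iff: "dpow L n f = 0 \<longleftrightarrow> (L ^^ n) f = 0"
  by (simp add: dpow_def)

lemma dpow_commute: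
  assumes "op_linear M" "\<And>f. L (M f) = M (L f)"
  shows "dpow L n (M f) = M (dpow L n f)"
  using assms by (simp add: dpow_def funpow_commute_op op_smult)

text \<open>After multiplication by \<open>Suc n\<close>, the term \<open>?t i\<close> arises with
  weight \<open>i\<close> from \<open>a\<close> and weight \<open>Suc n - i\<close> from
  \<open>b\<close>; the factor \<open>Suc n\<close> then cancels.\<close>

lemma dpow_binomial:
  assumes a: "op_linear a" and b: "op_linear b" and ab: "\<And>f. a (b f) = b (a f)"
  shows "dpow (\<lambda>f. a f + b f) n f = (\<Sum>i\<le>n. dpow a i (dpow b (n - i) f))"
proof (induction n arbitrary: f)
  case (Suc n)
  let ?t = "\<lambda>i. dpow a i (dpow b (Suc n - i) f)"
  have lin: "op_linear (dpow a i)" for i by (rule op_linear_dpow[OF a])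
  have "of_nat (Suc n) * dpow (\<lambda>f. a f + b f) (Suc n) f
      = (\<Sum>i\<le>n. dpow a i (dpow b (n - i) (a f + b f)))"
    by (simp only: Suc.IH flip: dpow_Suc)
  also have "\<dots> = (\<Sum>i\<le>n. dpow a i (dpow b (n - i) (a f))) + (\<Sum>i\<le>n. dpow a i (dpow b (n - i) (b f)))"
    by (simp add: op_add[OF lin] op_add[OF op_linear_dpow[OF b]] sum.distrib)
  \<comment> \<open>The shift adds a term \<open>i = 0\<close> of weight 0. In the sum for
    \<open>b\<close> the added term \<open>i = Suc n\<close> has weight 0 as well.\<close>
  also have "(\<Sum>i\<le>n. dpow a i (dpow b (n - i) (a f))) = (\<Sum>i\<le>Suc n. of_nat i * ?t i)"
    unfolding sum.atMost_Suc_shift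
    by (simp add: dpow_commute[OF a, of b] ab dpow_Suc del: of_nat_Suc)
  also have "(\<Sum>i\<le>n. dpow a i (dpow b (n - i) (b f))) = (\<Sum>i\<le>Suc n. of_nat (Suc n - i) * ?t i)"
    by (auto simp: dpow_Suc op_of_nat[OF lin] Suc_diff_le simp del: of_nat_Suc of_nat_diff intro!: sum.cong)
  also have "(\<Sum>i\<le>Suc n. of_nat i * ?t i) + (\<Sum>i\<le>Suc n. of_nat (Suc n - i) * ?t i)
      = (\<Sum>i\<le>Suc n. of_nat (Suc n) * ?t i)"
    unfolding sum.distrib[symmetric]
    by (intro sum.cong) (auto simp flip: distrib_right of_nat_add)
  also have "\<dots> = of_nat (Suc n) * (\<Sum>i\<le>Suc n. ?t i)"
    by (simp only: sum_distrib_left)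
  finally show ?case by (simp del: of_nat_Suc sum.atMost_Suc)
qed simp

section \<open>The Leibniz rule through Taylor series\<close>

definition derivation :: "(cpoly_xy \<Rightarrow> cpoly_xy) \<Rightarrow> bool" where
  "derivation d \<longleftrightarrow> op_linear d \<and> (\<forall>f g. d (f * g) = d f * g + f * d g)"

text \<open>This is \<open>exp(X d) f\<close>, the generating series of the divided powers.\<close>

definition taylor :: "(cpoly_xy \<Rightarrow> cpoly_xy) \<Rightarrow> cpoly_xy \<Rightarrow> cpoly_xy fps" where
  "taylor d f = Abs_fps (\<lambda>n. dpow d n f)"

lemma taylor_nth [simp]: "taylor d f $ n = dpow d n f"
  by (simp add: taylor_def)

lemma fps_deriv_taylor: "fps_deriv (taylor d f) = taylor d (d f)"
  by (rule fps_ext) (simp add: dpow_Suc)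

text \<open>Formal differentiation turns both sides into the same product rule, so coefficient
  \<open>Suc n\<close> follows from coefficient \<open>n\<close> for the pairs \<open>d f\<close>,
  \<open>g\<close> and \<open>f\<close>, \<open>d g\<close>.\<close>

lemma taylor_mult:
  assumes "derivation d" shows "taylor d (f * g) = taylor d f * taylor d g"
proof (rule fps_ext)
  fix n show "taylor d (f * g) $ n = (taylor d f * taylor d g) $ n"
  proof (induction n arbitrary: f g)
    case (Suc n)
    have "of_nat (Suc n) * (taylor d (f * g) $ Suc n) = taylor d (d (f * g)) $ n"
      by (simp only: taylor_nth dpow_Suc)
    also have "\<dots> = taylor d (d f * g) $ n + taylor d (f * d g) $ n"
      using assms by (auto simp: derivation_def op_add[OF op_linear_dpow])
    also have "\<dots> = fps_deriv (taylor d f * taylor d g) $ n"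
      by (simp only: Suc.IH) (simp add: fps_deriv_taylor)
    also have "\<dots> = of_nat (Suc n) * ((taylor d f * taylor d g) $ Suc n)"
      by (simp only: fps_deriv_nth Suc_eq_plus1)
    finally show ?case by (simp del: of_nat_Suc)
  qed simp
qed

lemma taylor_power:
  assumes "derivation d" shows "taylor d (f ^ Suc n) = taylor d f ^ Suc n"
  by (induction n) (simp_all add: taylor_mult[OF assms])

lemma dpow_mult:
  "derivation d \<Longrightarrow> dpow d n (f * g) = (\<Sum>i\<le>n. dpow d i f * dpow d (n - i) g)"
  using arg_cong[OF taylor_mult, of d "\<lambda>F. F $ n" f g] by (simp add: fps_mult_nth atMost_atLeast0)

text \<open>Freshman's dream with an explicit error term: modulo \<open>q\<close>, the series
  \<open>U\<^sup>q\<close> agrees with \<open>u\<^sub>0\<^sup>q + X\<^sup>q V\<^sup>q\<close> where \<open>U = u\<^sub>0 + X V\<close>.\<close>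

lemma fps_power_prime_nth:
  fixes U :: "'a::comm_ring_1 fps"
  assumes A: "subring_set A" and U: "\<And>n. U $ n \<in> A" and q: "prime q" and n: "0 < n" "n \<le> q"
  shows "\<exists>z\<in>A. (U ^ q) $ n = (if n = q then (U $ 1) ^ q else 0) + of_nat q * z"
proof -
  define F where "F = {V :: 'a fps. \<forall>n. V $ n \<in> A}"
  have F: "subring_set F"
    unfolding subring_set_def F_def
    by (auto simp: fps_mult_nth intro!: subring_sum[OF A] subring_one[OF A]
      subring_zero[OF A] subring_diff[OF A] subring_mult[OF A])
  define V where "V = Abs_fps (\<lambda>n. U $ Suc n)"
  define c where "c = fps_const (U $ 0)"
  have V: "V \<in> F" "fps_X * V \<in> F" and c: "c \<in> F"
    using U by (auto simp: F_def V_def c_def intro: subring_zero[OF A])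
  have UV: "U = c + fps_X * V"
    by (rule fps_ext) (auto simp: c_def V_def)
  \<comment> \<open>The interior binomial coefficients are divisible by the prime \<open>q\<close>;
    \<open>W\<close> is what remains of the mixed terms after removing that factor.\<close>
  define W where "W = (\<Sum>k\<in>{0<..<q}. of_nat ((q choose k) div q) * c ^ k * (fps_X * V) ^ (q - k))"
  have W: "W \<in> F"
    unfolding W_def by (intro subring_sum[OF F] subring_mult[OF F] subring_power[OF F] V c subring_of_nat[OF F])
  have q0: "q > 0" using q by (simp add: prime_gt_0_nat)
  have split: "{..q} = insert 0 (insert q {0<..<q})" using q0 by auto
  have "U ^ q = (\<Sum>k\<le>q. of_nat (q choose k) * c ^ k * (fps_X * V) ^ (q - k))"
    unfolding UV by (rule binomial_ring)
  also have "\<dots> = (fps_X * V) ^ q + c ^ q + (\<Sum>k\<in>{0<..<q}. of_nat (q choose k) * c ^ k * (fps_X * V) ^ (q - k))"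
    unfolding split using q0 by simp
  also have "(\<Sum>k\<in>{0<..<q}. of_nat (q choose k) * c ^ k * (fps_X * V) ^ (q - k)) = of_nat q * W"
    unfolding W_def sum_distrib_left
  proof (rule sum.cong[OF refl])
    fix k assume "k \<in> {0<..<q}"
    then have "q dvd (q choose k)" using q by (intro dvd_choose_prime) auto
    then have "(of_nat (q choose k) :: 'a fps) = of_nat q * of_nat ((q choose k) div q)"
      by (simp flip: of_nat_mult)
    then show "of_nat (q choose k) * c ^ k * (fps_X * V) ^ (q - k) =
       of_nat q * (of_nat ((q choose k) div q) * c ^ k * (fps_X * V) ^ (q - k))" by (simp add: mult.assoc)
  qed
  finally have eq: "U ^ q = fps_X ^ q * V ^ q + c ^ q + of_nat q * W"
    by (simp add: power_mult_distrib)
  \<comment> \<open>For \<open>0 < n \<le> q\<close> the constant series contributes nothing, and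
    \<open>fps_X ^ q * V ^ q\<close> contributes only at \<open>n = q\<close>, through the constant
    term of \<open>V ^ q\<close>.\<close>
  have "(c ^ q) $ n = 0" using n by (simp add: c_def)
  moreover have "(V ^ q) $ 0 = (U $ 1) ^ q" by (simp add: fps_power_zeroth V_def)
  moreover have "(of_nat q * W) $ n = of_nat q * (W $ n)" by (simp add: fps_of_nat[symmetric])
  ultimately show ?thesis using W n
    by (intro bexI[of _ "W $ n"]) (auto simp: eq fps_X_power_mult_nth F_def)
qed


section \<open>Integrality of the divided powers\<close>

text \<open>One family covers \<open>partial_y\<close>, with parameters 0 and 1, and the first-order
  part of \<Lambda>, with parameters 1 and \<open>- c\<close>.\<close>

definition dir_deriv :: "complex \<Rightarrow> complex \<Rightarrow> cpoly_xy \<Rightarrow> cpoly_xy" where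
  "dir_deriv \<alpha> \<beta> f = smult [:\<alpha>:] (partial_x f) + smult [:\<beta>:] (partial_y f)"

lemma coeff_partial_x: "coeff (partial_x f) n = pderiv (coeff f n)"
  by (simp add: partial_x_def coeff_map_poly)

lemma op_linear_partial_x: "op_linear partial_x"
  by (simp add: op_linear_def poly_eq_iff coeff_partial_x pderiv_add pderiv_smult)

lemma op_linear_partial_y: "op_linear partial_y"
  by (simp add: op_linear_def partial_y_def pderiv_add pderiv_smult)

lemma partial_x_mult: "partial_x (f * g) = partial_x f * g + f * partial_x g"
proof (rule poly_eqI)
  fix n show "coeff (partial_x (f * g)) n = coeff (partial_x f * g + f * partial_x g) n"
    unfolding coeff_partial_x coeff_add coeff_mult higher_pderiv_sum[where n = 1, simplified]
      pderiv_mult sum.distrib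
    by (simp add: add.commute mult.commute)
qed

lemma partial_y_mult: "partial_y (f * g) = partial_y f * g + f * partial_y g"
  by (simp add: partial_y_def pderiv_mult algebra_simps)

lemma partial_xy_commute: "partial_x (partial_y f) = partial_y (partial_x f)"
  by (rule poly_eqI)
    (simp add: coeff_partial_x partial_y_def coeff_pderiv pderiv_mult del: of_nat_Suc)

lemma derivation_dir_deriv: "derivation (dir_deriv \<alpha> \<beta>)"
  by (simp add: derivation_def op_linear_def dir_deriv_def op_add[OF op_linear_partial_x]
      op_add[OF op_linear_partial_y] op_smult[OF op_linear_partial_x]
      op_smult[OF op_linear_partial_y] partial_x_mult partial_y_mult smult_add_right algebra_simps)

lemma partial_y_eq_dir_deriv: "partial_y = dir_deriv 0 1"
  by (rule ext) (simp add: dir_deriv_def flip: one_pCons)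

text \<open>By Horner's scheme in each variable, \<open>A[x,y]\<close> is generated as a ring by the
  constants, x (\<open>[:[:0, 1:]:]\<close>) and y (\<open>[:0, 1:]\<close>).\<close>

lemma poly_xy_induct [consumes 2, case_names const x y add mult]:
  assumes A: "subring_set A" and f: "f \<in> polys_over (polys_over A)"
    and const: "\<And>c. c \<in> A \<Longrightarrow> H [:[:c:]:]"
    and x: "H [:[:0, 1:]:]" and y: "H [:0, 1:]"
    and add: "\<And>f g. H f \<Longrightarrow> H g \<Longrightarrow> H (f + g)"
    and mult: "\<And>f g. H f \<Longrightarrow> H g \<Longrightarrow> H (f * g)"
  shows "H (f :: cpoly_xy)"
proof -
  have coeffs: "H [:p:]" if "p \<in> polys_over A" for p
    using that
  proof (induction p)
    case 0
    show ?case using const[OF subring_zero[OF A]] by simp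
  next
    case (pCons c p)
    then have "H ([:[:c:]:] + [:[:0, 1:]:] * [:p:])"
      by (intro add mult x const) (auto simp: pCons_polys_over[OF A])
    then show ?case by simp
  qed
  show ?thesis
    using f
  proof (induction f)
    case 0
    show ?case using const[OF subring_zero[OF A]] by simp
  next
    case (pCons p f)
    then have "H ([:p:] + [:0, 1:] * f)"
      by (intro add mult y coeffs) (auto simp: pCons_polys_over[OF subring_polys_over[OF A]])
    then show ?case by simp
  qed
qed

lemma dir_deriv_const: "dir_deriv \<alpha> \<beta> [:[:c:]:] = 0"
  and dir_deriv_x: "dir_deriv \<alpha> \<beta> [:[:0, 1:]:] = [:[:\<alpha>:]:]"
  and dir_deriv_y: "dir_deriv \<alpha> \<beta> [:0, 1:] = [:[:\<beta>:]:]"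
  by (simp_all add: dir_deriv_def partial_x_def partial_y_def map_poly_pCons pderiv_pCons)

lemma dpow_dir_deriv_const:
  "n \<ge> 1 \<Longrightarrow> dpow (dir_deriv \<alpha> \<beta>) n [:[:c:]:] = 0"
  using op_zero[OF op_linear_funpow[of "dir_deriv \<alpha> \<beta>" "n - 1"]] derivation_dir_deriv[of \<alpha> \<beta>]
  by (cases n) (auto simp: dpow_def dir_deriv_const funpow_Suc_right derivation_def simp del: funpow.simps)

lemma dpow_dir_deriv_linear:
  assumes "dir_deriv \<alpha> \<beta> f = [:[:c:]:]"
  shows "dpow (dir_deriv \<alpha> \<beta>) n f = (if n = 0 then f else if n = 1 then [:[:c:]:] else 0)"
proof (cases n)
  case (Suc m)
  have "of_nat (Suc m) * dpow (dir_deriv \<alpha> \<beta>) (Suc m) f = dpow (dir_deriv \<alpha> \<beta>) m [:[:c:]:]"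
    by (simp only: assms flip: dpow_Suc)
  then show ?thesis using Suc dpow_dir_deriv_const[of m \<alpha> \<beta> c]
    by (cases m) (simp_all del: of_nat_Suc add: of_nat_Suc[of 0])
qed simp

text \<open>The denominators n! do no harm: on the generators divided powers vanish from order 2 on,
  and the Leibniz rule for divided powers has no coefficients.\<close>

lemma dpow_dir_deriv_polys_over:
  assumes A: "subring_set A" and \<alpha>: "\<alpha> \<in> A" and \<beta>: "\<beta> \<in> A" and f: "f \<in> polys_over (polys_over A)"
  shows "dpow (dir_deriv \<alpha> \<beta>) n f \<in> polys_over (polys_over A)"
proof -
  note R1 = subring_polys_over[OF A]
  note R = subring_polys_over[OF R1]
  note const_mem = pCons_polys_over[OF A] pCons_polys_over[OF R1] subring_zero[OF A] subring_zero[OF R1]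
    subring_zero[OF R] subring_one[OF A] subring_one[OF R1]
  from A f have "\<forall>n. dpow (dir_deriv \<alpha> \<beta>) n f \<in> polys_over (polys_over A)"
  proof (induction f rule: poly_xy_induct)
    case (const c)
    show ?case
    proof
      fix n show "dpow (dir_deriv \<alpha> \<beta>) n [:[:c:]:] \<in> polys_over (polys_over A)"
        using const by (cases n) (simp_all add: const_mem dpow_dir_deriv_const)
    qed
  next
    case x
    show ?case by (simp add: dpow_dir_deriv_linear[OF dir_deriv_x] const_mem \<alpha>)
  next
    case y
    show ?case by (simp add: dpow_dir_deriv_linear[OF dir_deriv_y] const_mem \<beta>)
  next
    case (add f g)
    then show ?case
      using derivation_dir_deriv[of \<alpha> \<beta>]
      by (auto simp: derivation_def op_add[OF op_linear_dpow] intro: subring_add[OF R])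
  next
    case (mult f g)
    then show ?case
      by (auto simp: dpow_mult[OF derivation_dir_deriv] intro!: subring_sum[OF R] subring_mult[OF R])
  qed
  then show ?thesis ..
qed

lemma dpow_dir_deriv_nilpotent: "\<exists>E. \<forall>n\<ge>E. dpow (dir_deriv \<alpha> \<beta>) n f = 0"
proof -
  \<comment> \<open>Taking all of \<complex> as the subring makes the induction rule apply to every
    polynomial.\<close>
  have "subring_set (UNIV :: complex set)" "f \<in> polys_over (polys_over UNIV)"
    by (auto simp: subring_set_def polys_over_def)
  then show ?thesis
  proof (induction f rule: poly_xy_induct)
    case (const c)
    show ?case by (auto simp: dpow_dir_deriv_const intro: exI[of _ 1])
  next
    case x
    show ?case by (auto simp: dpow_dir_deriv_linear[OF dir_deriv_x] intro!: exI[of _ 2])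
  next
    case y
    show ?case by (auto simp: dpow_dir_deriv_linear[OF dir_deriv_y] intro!: exI[of _ 2])
  next
    case (add f g)
    then obtain E F where "\<forall>n\<ge>E. dpow (dir_deriv \<alpha> \<beta>) n f = 0" "\<forall>n\<ge>F. dpow (dir_deriv \<alpha> \<beta>) n g = 0"
      by blast
    then show ?case
      using derivation_dir_deriv[of \<alpha> \<beta>]
      by (intro exI[of _ "max E F"]) (auto simp: derivation_def op_add[OF op_linear_dpow])
  next
    case (mult f g)
    then obtain E F where EF: "\<forall>n\<ge>E. dpow (dir_deriv \<alpha> \<beta>) n f = 0" "\<forall>n\<ge>F. dpow (dir_deriv \<alpha> \<beta>) n g = 0"
      by blast
    \<comment> \<open>If \<open>n \<ge> E + F\<close>, then \<open>i \<ge> E\<close> or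
      \<open>n - i \<ge> F\<close>.\<close>
    have "dpow (dir_deriv \<alpha> \<beta>) i f * dpow (dir_deriv \<alpha> \<beta>) (n - i) g = 0" if "n \<ge> E + F" for n i
      using EF that by (cases "i \<ge> E") auto
    then show ?case
      by (intro exI[of _ "E + F"]) (auto simp only: dpow_mult[OF derivation_dir_deriv] intro!: sum.neutral)
  qed
qed

section \<open>Constant-coefficient operators in \<open>partial_y\<close>\<close>

lemma subst_partial_y_extend:
  assumes "degree \<Phi> \<le> n"
  shows "subst_partial_y \<Phi> f = (\<Sum>i\<le>n. smult [:coeff \<Phi> i:] ((partial_y ^^ i) f))"
  unfolding subst_partial_y_def
  by (rule sum.mono_neutral_left) (use assms in \<open>auto simp: not_le coeff_eq_0\<close>)

text \<open>The Horner recursion, which opens the way to induction on the symbol \<Phi>.\<close>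

lemma subst_partial_y_pCons:
  "subst_partial_y (pCons a \<Phi>) f = smult [:a:] f + subst_partial_y \<Phi> (partial_y f)"
proof -
  have "subst_partial_y (pCons a \<Phi>) f
      = (\<Sum>i\<le>Suc (degree \<Phi>). smult [:coeff (pCons a \<Phi>) i:] ((partial_y ^^ i) f))"
    by (rule subst_partial_y_extend) (simp add: degree_pCons_le)
  also have "\<dots> = smult [:a:] f + (\<Sum>i\<le>degree \<Phi>. smult [:coeff \<Phi> i:] ((partial_y ^^ i) (partial_y f)))"
    unfolding sum.atMost_Suc_shift by (simp add: funpow_swap1)
  finally show ?thesis by (simp add: subst_partial_y_def)
qed

lemma subst_partial_y_0 [simp]: "subst_partial_y 0 f = 0"
  by (simp add: subst_partial_y_def)

lemma op_linear_subst_partial_y: "op_linear (subst_partial_y \<Phi>)"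
proof (induction \<Phi>)
  case (pCons a \<Phi>)
  then show ?case
    by (simp add: op_linear_def subst_partial_y_pCons op_add[OF op_linear_partial_y]
        op_smult[OF op_linear_partial_y] smult_add_right algebra_simps)
qed (simp add: op_linear_def)

lemma subst_partial_y_commute:
  assumes L: "op_linear L" and comm: "\<And>f. L (partial_y f) = partial_y (L f)"
  shows "L (subst_partial_y \<Phi> f) = subst_partial_y \<Phi> (L f)"
  by (induction \<Phi> arbitrary: f)
    (simp_all add: subst_partial_y_pCons op_zero[OF L] op_add[OF L] op_smult[OF L] comm)

lemma subst_partial_y_uminus: "subst_partial_y (- \<Phi>) f = - subst_partial_y \<Phi> f"
proof -
  have "[:- c:] = - [:c :: complex:]" for c by simp
  then show ?thesis
    unfolding subst_partial_y_def by (simp only: degree_minus coeff_minus smult_minus_left sum_negf)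
qed

lemma dir_deriv_partial_y: "dir_deriv \<alpha> \<beta> (partial_y f) = partial_y (dir_deriv \<alpha> \<beta> f)"
  by (simp add: dir_deriv_def partial_xy_commute op_add[OF op_linear_partial_y]
      op_smult[OF op_linear_partial_y])

lemma op_linear_dir_deriv: "op_linear (dir_deriv \<alpha> \<beta>)"
  using derivation_dir_deriv by (simp add: derivation_def)

lemma const_smult_polys_over:
  assumes A: "subring_set A" "c \<in> A" "f \<in> polys_over (polys_over A)"
  shows "smult [:c:] f \<in> polys_over (polys_over A)"
  using assms by (intro smult_polys_over subring_polys_over)
    (simp_all add: pCons_polys_over subring_zero subring_polys_over)

lemma subst_partial_y_polys_over:
  assumes A: "subring_set A" and "\<Phi> \<in> polys_over A" "f \<in> polys_over (polys_over A)"
  shows "subst_partial_y \<Phi> f \<in> polys_over (polys_over A)"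
  using assms(2,3)
proof (induction \<Phi> arbitrary: f)
  case 0
  then show ?case by (simp add: subring_zero subring_polys_over A)
next
  case (pCons a \<Phi>)
  have "partial_y f \<in> polys_over (polys_over A)"
    using dpow_dir_deriv_polys_over[OF A _ _ pCons.prems(2), of 0 1 1] A
    by (simp add: dpow_def subring_zero subring_one flip: one_pCons partial_y_eq_dir_deriv)
  then show ?case
    using pCons by (auto simp: subst_partial_y_pCons pCons_polys_over[OF A]
        intro!: subring_add const_smult_polys_over subring_polys_over A)
qed

section \<open>Reduction modulo a prime\<close>

lemma funpow_subst_partial_y:
  "((\<lambda>f. subst_partial_y \<Phi> ((partial_y ^^ k) f)) ^^ n) f
    = (partial_y ^^ (k * n)) ((subst_partial_y \<Phi> ^^ n) f)"
proof (induction n)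
  case (Suc n)
  have comm: "subst_partial_y \<Phi> ((partial_y ^^ j) h) = (partial_y ^^ j) (subst_partial_y \<Phi> h)" for j h
    by (rule subst_partial_y_commute[symmetric])
      (simp_all add: op_linear_funpow op_linear_partial_y funpow_swap1)
  show ?case unfolding funpow.simps o_apply Suc.IH by (simp add: comm funpow_add)
qed simp

text \<open>Order two enters here: (2n)! is n! times n! times an integer. Hence the 2n-th power of
  \<open>partial_y\<close>, divided by n!, keeps a factor n! in front of an integral divided
  power.\<close>

lemma dpow_second_order:
  assumes A: "subring_set A" and \<Psi>: "\<Psi> \<in> polys_over A" and f: "f \<in> polys_over (polys_over A)"
  shows "\<exists>h\<in>polys_over (polys_over A).
    dpow (\<lambda>f. subst_partial_y \<Psi> (partial_y (partial_y f))) n f = of_nat (fact n) * h"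
proof -
  note R = subring_polys_over[OF subring_polys_over[OF A]]
  define g where "g = (subst_partial_y \<Psi> ^^ n) f"
  have "(subst_partial_y \<Psi> ^^ n) f \<in> polys_over (polys_over A)"
    by (induction n) (auto intro: f subst_partial_y_polys_over[OF A \<Psi>])
  then have h: "dpow partial_y (2 * n) g \<in> polys_over (polys_over A)"
    using dpow_dir_deriv_polys_over[OF A subring_zero[OF A] subring_one[OF A]]
    by (simp add: g_def partial_y_eq_dir_deriv)
  have "fact n * fact (2 * n - n) * (2 * n choose n) = fact (2 * n)"
    by (rule binomial_fact_lemma) simp
  then have F: "(fact (2 * n) :: nat) = fact n * (fact n * (2 * n choose n))"
    by (simp add: mult.assoc)
  have "dpow (\<lambda>f. subst_partial_y \<Psi> (partial_y (partial_y f))) n f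
      = smult [:1 / fact n:] ((partial_y ^^ (2 * n)) g)"
    using funpow_subst_partial_y[where \<Phi> = \<Psi> and k = 2 and n = n and f = f] by (simp add: dpow_def g_def numeral_2_eq_2)
  also have "\<dots> = smult [:1 / fact n:] (of_nat (fact n) *
      (of_nat (fact n * (2 * n choose n)) * dpow partial_y (2 * n) g))"
    by (simp only: funpow_eq_dpow F of_nat_mult mult.assoc)
  also have "\<dots> = of_nat (fact n * (2 * n choose n)) * dpow partial_y (2 * n) g"
    by (simp only: of_nat_mult_poly_xy[of "fact n"] smult_smult) (simp flip: one_pCons)
  also have "\<dots> = of_nat (fact n) * (of_nat (2 * n choose n) * dpow partial_y (2 * n) g)"
    by (simp add: mult.assoc)
  finally show ?thesis using h
    by (intro bexI[of _ "of_nat (2 * n choose n) * dpow partial_y (2 * n) g"])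
      (auto intro: subring_mult[OF R] subring_of_nat[OF R])
qed

text \<open>In \<open>\<Lambda>\<^sup>q/q! = \<Sum>i\<le>q. a\<^sup>i/i! \<cdot> d\<^sup>q\<^sup>-\<^sup>i/(q-i)!\<close> the terms with \<open>0 < i < q\<close> vanish
  modulo \<open>q\<close> on \<open>q\<close>-th powers, and the term \<open>i = q\<close> vanishes because \<open>a\<close> has order at least
  two in \<open>\<partial>\<^sub>y\<close>.\<close>

lemma dpow_prime_congruence:
  assumes A: "subring_set A" and \<Psi>: "\<Psi> \<in> polys_over A" and \<alpha>: "\<alpha> \<in> A" "\<beta> \<in> A"
    and f: "f \<in> polys_over (polys_over A)" and q: "prime q"
  shows "\<exists>h\<in>polys_over (polys_over A).
    dpow (\<lambda>f. subst_partial_y \<Psi> (partial_y (partial_y f)) + dir_deriv \<alpha> \<beta> f) q (f ^ q)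
      = (dir_deriv \<alpha> \<beta> f) ^ q + of_nat q * h"
proof -
  let ?R = "polys_over (polys_over A)"
  note R = subring_polys_over[OF subring_polys_over[OF A]]
  define d where "d = dir_deriv \<alpha> \<beta>"
  define a where "a = (\<lambda>f. subst_partial_y \<Psi> (partial_y (partial_y f)))"
  have lin_a: "op_linear a"
    unfolding op_linear_def a_def
    by (simp add: op_add[OF op_linear_partial_y] op_smult[OF op_linear_partial_y]
        op_add[OF op_linear_subst_partial_y] op_smult[OF op_linear_subst_partial_y])
  have lin_d: "op_linear d" by (simp add: d_def op_linear_dir_deriv)
  have ad: "a (d h) = d (a h)" for h
    by (simp add: a_def d_def dir_deriv_partial_y
        subst_partial_y_commute[OF op_linear_dir_deriv dir_deriv_partial_y])
  have q0: "q > 0" using q by (simp add: prime_gt_0_nat)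
  \<comment> \<open>The series \<open>taylor d f\<close> has integral coefficients and
    \<open>d f\<close> at index 1, so the prime power congruence applies to its \<open>q\<close>-th
    power, which is \<open>taylor d (f ^ q)\<close>.\<close>
  have "\<exists>z\<in>?R. dpow d n (f ^ q) = (if n = q then (d f) ^ q else 0) + of_nat q * z"
    if "0 < n" "n \<le> q" for n
  proof -
    have "taylor d f $ k \<in> ?R" for k
      using dpow_dir_deriv_polys_over[OF A \<alpha> f] by (simp add: d_def)
    moreover have "dpow d n (f ^ q) = (taylor d f ^ q) $ n"
      using taylor_power[OF derivation_dir_deriv, of \<alpha> \<beta> f "q - 1"] q0
      by (simp add: d_def flip: taylor_nth)
    ultimately show ?thesis using fps_power_prime_nth[OF R _ q that, of "taylor d f"]
      by (cases "n = q") simp_all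
  qed
  then obtain z where z: "\<And>n. 0 < n \<Longrightarrow> n \<le> q \<Longrightarrow> z n \<in> ?R"
    and z_eq: "\<And>n. 0 < n \<Longrightarrow> n \<le> q \<Longrightarrow>
      dpow d n (f ^ q) = (if n = q then (d f) ^ q else 0) + of_nat q * z n"
    by metis
  have dpow_a: "\<exists>h\<in>?R. dpow a i g = of_nat (fact i) * h" if "g \<in> ?R" for i g
    unfolding a_def by (rule dpow_second_order[OF A \<Psi> that])
  have terms: "\<exists>h\<in>?R. dpow a i (dpow d (q - i) (f ^ q)) = (if i = 0 then (d f) ^ q else 0) + of_nat q * h"
    if i: "i \<le> q" for i
  proof (cases "i = 0 \<or> i = q")
    case False
    then have "dpow d (q - i) (f ^ q) = of_nat q * z (q - i)" "z (q - i) \<in> ?R"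
      using z_eq[of "q - i"] z[of "q - i"] i by auto
    then show ?thesis
      using False dpow_a[of "z (q - i)" i]
      by (auto simp: op_of_nat[OF op_linear_dpow[OF lin_a]]
          intro!: bexI[of _ "of_nat (fact i) * _"] subring_mult[OF R] subring_of_nat[OF R])
  next
    case True
    then show ?thesis
    proof
      assume "i = 0"
      then show ?thesis using z_eq[of q] z[of q] q0 by auto
    next
      assume [simp]: "i = q"
      obtain h where h: "h \<in> ?R" "dpow a q (f ^ q) = of_nat (fact q) * h"
        using dpow_a[OF subring_power[OF R f]] by blast
      have "(of_nat (fact q) :: cpoly_xy) = of_nat q * of_nat (fact (q - 1))"
        using q0 by (simp only: fact_reduce[of q] of_nat_mult of_nat_id)
      then show ?thesis using h q0
        by (auto simp: mult.assoc intro!: bexI[of _ "of_nat (fact (q - 1)) * h"]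
            subring_mult[OF R] subring_of_nat[OF R] simp del: of_nat_fact)
    qed
  qed
  then obtain h where h: "\<And>i. i \<le> q \<Longrightarrow> h i \<in> ?R"
    and h_eq: "\<And>i. i \<le> q \<Longrightarrow>
      dpow a i (dpow d (q - i) (f ^ q)) = (if i = 0 then (d f) ^ q else 0) + of_nat q * h i"
    by metis
  have "dpow (\<lambda>f. a f + d f) q (f ^ q) = (\<Sum>i\<le>q. dpow a i (dpow d (q - i) (f ^ q)))"
    by (rule dpow_binomial[OF lin_a lin_d ad])
  also have "\<dots> = (\<Sum>i\<le>q. (if i = 0 then (d f) ^ q else 0) + of_nat q * h i)"
    by (intro sum.cong) (auto simp: h_eq)
  also have "\<dots> = (d f) ^ q + of_nat q * (\<Sum>i\<le>q. h i)"
    by (simp add: sum.distrib sum_distrib_left)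
  finally show ?thesis
    using subring_sum[OF R, of "{..q}" h] h unfolding a_def d_def by auto
qed


section \<open>The vanishing theorem\<close>

text \<open>Every \<open>partial_y\<close> lowers the degree in y, so only the constant term
  \<open>c\<close> of the symbol reaches the top coefficient.\<close>

lemma coeff_lead_subst_partial_y:
  "coeff (subst_partial_y (pCons c \<Phi>) f) (degree f) = smult c (lead_coeff f)"
proof -
  have deg: "degree (subst_partial_y \<Psi> g) \<le> degree g" for \<Psi> g
  proof (induction \<Psi> arbitrary: g)
    case (pCons b \<Psi>)
    have "degree (subst_partial_y \<Psi> (partial_y g)) \<le> degree g"
      using pCons.IH[of "partial_y g"] by (simp add: partial_y_def degree_pderiv)
    then show ?case
      by (simp add: subst_partial_y_pCons degree_add_le order.trans[OF degree_smult_le])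
  qed simp
  have "coeff (subst_partial_y \<Phi> (partial_y f)) (degree f) = 0"
  \<comment> \<open>In degree 0 the truncated \<open>degree f - 1\<close> is not smaller than
    \<open>degree f\<close>, but there the derivative itself vanishes.\<close>
  proof (cases "degree f = 0")
    case True
    then have "partial_y f = 0" by (simp add: partial_y_def pderiv_eq_0_iff)
    then show ?thesis by (simp add: op_zero[OF op_linear_subst_partial_y])
  next
    case False
    then show ?thesis
      using deg[of \<Phi> "partial_y f"] by (intro coeff_eq_0) (simp add: partial_y_def degree_pderiv)
  qed
  then show ?thesis by (simp add: subst_partial_y_pCons)
qed

lemma subst_partial_y_eq_0D:
  "c \<noteq> 0 \<Longrightarrow> subst_partial_y (pCons c \<Phi>) f = 0 \<Longrightarrow> f = 0"
  using coeff_lead_subst_partial_y[of c \<Phi> f] by auto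

text \<open>The top coefficient in y of a nonzero solution would be a nonzero polynomial
  \<open>p\<close> in x with \<open>p' = c p\<close>, which is impossible by degree.\<close>

lemma Lambda_op_eq_0D:
  assumes "c \<noteq> 0" "Lambda_op (pCons c \<Phi>) f = 0" shows "f = 0"
proof (rule ccontr)
  assume "f \<noteq> 0"
  have "pderiv (lead_coeff f) = smult c (lead_coeff f)"
    using arg_cong[OF assms(2), of "\<lambda>g. coeff g (degree f)"]
    by (simp add: Lambda_op_def coeff_partial_x coeff_lead_subst_partial_y)
  then have "degree (pderiv (lead_coeff f)) = degree (lead_coeff f)" "pderiv (lead_coeff f) \<noteq> 0"
    using assms(1) \<open>f \<noteq> 0\<close> by auto
  then show False by (simp add: degree_pderiv pderiv_eq_0_iff)
qed

lemma Lambda_op_pCons_0: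
  "Lambda_op (pCons 0 (pCons c \<Phi>)) f
    = subst_partial_y (- \<Phi>) (partial_y (partial_y f)) + dir_deriv 1 (- c) f"
proof -
  have "smult [:- c:] g = - smult [:c:] g" for g
    by (metis minus_pCons minus_zero smult_minus_left)
  then show ?thesis
    by (simp add: Lambda_op_def subst_partial_y_pCons subst_partial_y_uminus dir_deriv_def
        flip: one_pCons)
qed

text \<open>The arithmetic core: the hypothesis at one large prime \<open>m = q\<close> makes
  \<open>D ^ q\<close> divisible by \<open>q\<close>. Here \<open>\<Phi>\<close> plays the part of
  \<open>\<Phi>\<^sub>2\<close> in the overview.\<close>

lemma dir_deriv_eq_0:
  assumes hyp: "\<And>m. m \<ge> 1 \<Longrightarrow> (Lambda_op (pCons 0 (pCons c \<Phi>)) ^^ m) (P ^ m) = 0"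
  shows "dir_deriv 1 (- c) P = 0"
proof (rule ccontr)
  define D where "D = dir_deriv 1 (- c) P"
  assume "dir_deriv 1 (- c) P \<noteq> 0"
  then have D: "D \<noteq> 0" by (simp add: D_def)
  define S where "S = insert c (set (coeffs \<Phi>) \<union> (\<Union>p\<in>set (coeffs P). set (coeffs p)))"
  obtain A where fg: "fg_ring A" and S: "S \<subseteq> A"
    using fg_ring_superset[of S] by (auto simp: S_def)
  note A = subring_fg_ring[OF fg]
  have over: "p \<in> polys_over B" if "subring_set B" "set (coeffs p) \<subseteq> B"
    for B and p :: "'b::comm_ring_1 poly"
  proof (rule polys_overI)
    fix i
    have "coeff p i \<in> insert 0 (set (coeffs p))" using range_coeff[of p] by blast
    then show "coeff p i \<in> B" using that subring_zero by auto
  qed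
  have "\<Phi> \<in> polys_over A" using S by (intro over A) (auto simp: S_def)
  then have \<Phi>: "- \<Phi> \<in> polys_over A" by (rule subring_uminus[OF subring_polys_over[OF A]])
  have P: "P \<in> polys_over (polys_over A)"
    using S by (intro over subring_polys_over A subsetI) (auto simp: S_def)
  have c: "- c \<in> A" using S subring_uminus[OF A, of c] by (auto simp: S_def)
  have DA: "D \<in> polys_over (polys_over A)"
    using dpow_dir_deriv_polys_over[OF A subring_one[OF A] c P, of 1] by (simp add: D_def)
  \<comment> \<open>Leading coefficients are multiplicative, so \<open>a ^ q\<close> is itself a
    coefficient of \<open>D ^ q\<close>, and the divisibility descends to scalars in
    \<open>A\<close>.\<close>
  define a where "a = lead_coeff (lead_coeff D)"
  have "a \<in> A" "a \<noteq> 0" using DA D by (auto simp: a_def intro: polys_overD)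
  then obtain N where N: "\<And>q n z. q > N \<Longrightarrow> prime (q::nat) \<Longrightarrow> z \<in> A \<Longrightarrow> a ^ n \<noteq> of_nat q * z"
    using regular_at_primes_fg_ring[OF fg] unfolding regular_at_primes_def by metis
  obtain q where q: "prime q" "q > N" using bigger_prime by blast
  obtain h where h: "h \<in> polys_over (polys_over A)"
    and eq: "dpow (Lambda_op (pCons 0 (pCons c \<Phi>))) q (P ^ q) = D ^ q + of_nat q * h"
    using dpow_prime_congruence[OF A \<Phi> subring_one[OF A] c P q(1)]
    unfolding D_def Lambda_op_pCons_0[abs_def] by blast
  have "dpow (Lambda_op (pCons 0 (pCons c \<Phi>))) q (P ^ q) = 0"
    using hyp[OF prime_ge_1_nat[OF q(1)]] by (simp add: dpow_eq_0_iff)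
  then have Dq: "D ^ q = of_nat q * (- h)"
    using eq by (simp add: eq_neg_iff_add_eq_0)
  define z where "z = coeff (coeff (- h) (degree (D ^ q))) (degree (lead_coeff (D ^ q)))"
  have "a ^ q = coeff (coeff (D ^ q) (degree (D ^ q))) (degree (lead_coeff (D ^ q)))"
    by (simp only: a_def lead_coeff_power)
  also have "\<dots> = coeff (coeff (of_nat q * (- h)) (degree (D ^ q))) (degree (lead_coeff (D ^ q)))"
    by (simp only: Dq)
  also have "\<dots> = of_nat q * z"
    by (simp only: of_nat_mult_poly_xy z_def coeff_smult) simp
  finally have "a ^ q = of_nat q * z" .
  moreover have "z \<in> A"
    unfolding z_def using h
    by (intro polys_overD subring_uminus[OF subring_polys_over[OF subring_polys_over[OF A]]])
  ultimately show False using N q by blast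
qed

text \<open>Splits off the largest power of the variable from the symbol; the remaining factor has
  nonzero constant term and hence acts injectively.\<close>

lemma subst_partial_y_factor:
  assumes "\<Phi> \<noteq> 0"
  shows "\<exists>k c \<Psi>. c \<noteq> 0 \<and> (\<forall>f. subst_partial_y \<Phi> f = subst_partial_y (pCons c \<Psi>) ((partial_y ^^ k) f))"
  using assms
proof (induction \<Phi>)
  case (pCons b \<Phi>)
  show ?case
  proof (cases "b = 0")
    case False
    then show ?thesis by (intro exI[of _ 0] exI[of _ b] exI[of _ \<Phi>]) simp
  next
    case True
    with pCons obtain k c \<Psi> where "c \<noteq> 0"
      "\<And>f. subst_partial_y \<Phi> f = subst_partial_y (pCons c \<Psi>) ((partial_y ^^ k) f)" by auto
    with True show ?thesis
      by (intro exI[of _ "Suc k"] exI[of _ c] exI[of _ \<Psi>]) (simp add: subst_partial_y_pCons[of 0 \<Phi>] funpow_swap1)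
  qed
qed simp

lemma funpow_pderiv_eq_0_iff:
  fixes p :: "'a::{comm_ring_1,semiring_char_0,semiring_no_zero_divisors} poly"
  shows "(pderiv ^^ n) p = 0 \<longleftrightarrow> p = 0 \<or> degree p < n"
proof (induction n arbitrary: p)
  case (Suc n)
  have "(pderiv ^^ Suc n) p = (pderiv ^^ n) (pderiv p)" by (simp add: funpow_swap1)
  then show ?case using Suc.IH[of "pderiv p"] by (auto simp: pderiv_eq_0_iff degree_pderiv)
qed simp

text \<open>Fewer than \<open>E\<close> factors \<open>d\<close> can act on \<open>g\<close> without
  killing it, so more than \<open>m - E\<close> factors are \<open>a\<close>, each lowering the
  y-degree by \<open>K\<close>. The y-degree of \<open>P ^ m * g\<close> grows at most like
  \<open>(K - 1) * m\<close>, too slowly to survive.\<close>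

lemma eventually_vanishing:
  assumes \<Lambda>: "\<And>f. L f = subst_partial_y \<Psi> ((partial_y ^^ K) f) + dir_deriv \<alpha> \<beta> f"
    and dP: "dir_deriv \<alpha> \<beta> P = 0" and deg: "degree P < K"
  shows "\<exists>N\<ge>1. \<forall>m\<ge>N. (L ^^ m) (P ^ m * g) = 0"
proof -
  define d where "d = dir_deriv \<alpha> \<beta>"
  define a where "a = (\<lambda>f. subst_partial_y \<Psi> ((partial_y ^^ K) f))"
  note lin_yK = op_linear_funpow[OF op_linear_partial_y]
  have lin_a: "op_linear a"
    unfolding op_linear_def a_def
    by (simp add: op_add[OF lin_yK] op_smult[OF lin_yK]
        op_add[OF op_linear_subst_partial_y] op_smult[OF op_linear_subst_partial_y])
  have lin_d: "op_linear d" by (simp add: d_def op_linear_dir_deriv)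
  have dyK: "d ((partial_y ^^ j) h) = (partial_y ^^ j) (d h)" for j h
    by (rule funpow_commute_op[symmetric]) (simp add: d_def dir_deriv_partial_y)
  have ad: "a (d h) = d (a h)" for h
    using subst_partial_y_commute[OF lin_d, of \<Psi>] dyK[of 1] by (simp add: a_def dyK)
  \<comment> \<open>As \<open>d P = 0\<close>, the Leibniz rule makes \<open>d\<close> linear over
    powers of \<open>P\<close>.\<close>
  have "d (P ^ m * h) = P ^ m * d h" for m h
  proof (induction m)
    case (Suc m)
    have "d (P * (P ^ m * h)) = P * d (P ^ m * h)"
      using derivation_dir_deriv[of \<alpha> \<beta>] dP by (simp add: derivation_def d_def)
    then show ?case using Suc by (simp add: mult.assoc)
  qed simp
  then have "(d ^^ n) (P ^ m * h) = P ^ m * (d ^^ n) h" for m n h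
    by (rule funpow_commute_op[of d "\<lambda>h. P ^ m * h"])
  then have dpow_d: "dpow d n (P ^ m * h) = P ^ m * dpow d n h" for m n h
    by (simp add: dpow_def)
  have "degree (d h) \<le> degree h" for h
    by (rule degree_le)
      (simp add: d_def dir_deriv_def coeff_partial_x partial_y_def coeff_pderiv coeff_eq_0)
  then have "degree ((d ^^ n) g) \<le> degree g" for n
    by (induction n) (auto intro: order.trans)
  then have deg_d: "degree (dpow d n g) \<le> degree g" for n
    unfolding dpow_def by (rule order.trans[OF degree_smult_le])
  obtain E where E: "\<And>n. n \<ge> E \<Longrightarrow> dpow d n g = 0"
    using dpow_dir_deriv_nilpotent[of \<alpha> \<beta> g] by (auto simp: d_def)
  have a0: "dpow a i h = 0" if "degree h < K * i" for i h
  proof -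
    have "(a ^^ i) h = (partial_y ^^ (K * i)) ((subst_partial_y \<Psi> ^^ i) h)"
      unfolding a_def by (rule funpow_subst_partial_y)
    also have "\<dots> = (subst_partial_y \<Psi> ^^ i) ((partial_y ^^ (K * i)) h)"
      by (rule funpow_commute_op[symmetric], rule subst_partial_y_commute[symmetric])
        (simp_all add: lin_yK funpow_swap1)
    also have "(partial_y ^^ (K * i)) h = 0"
      using that unfolding partial_y_def[abs_def] by (simp add: funpow_pderiv_eq_0_iff)
    finally show ?thesis
      by (simp add: dpow_eq_0_iff op_zero[OF op_linear_funpow[OF op_linear_subst_partial_y]])
  qed
  have "(L ^^ m) (P ^ m * g) = 0" if m: "m \<ge> K * E + degree g + 1" for m
  proof -
    have "dpow a i (dpow d (m - i) (P ^ m * g)) = 0" if i: "i \<le> m" for i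
    proof (cases "m - i \<ge> E")
      case True
      then show ?thesis by (simp add: dpow_d E op_zero[OF op_linear_dpow[OF lin_a]])
    next
      case False
      \<comment> \<open>Together with \<open>degree P + 1 \<le> K\<close> and
        \<open>m \<le> i + E\<close>, this bound is below \<open>K * i\<close> because
        \<open>m\<close> exceeds \<open>K * E + degree g\<close>.\<close>
      have "degree (P ^ m * dpow d (m - i) g) \<le> degree P * m + degree g"
        using degree_mult_le[of "P ^ m" "dpow d (m - i) g"] degree_power_le[of P m] deg_d[of "m - i"]
        by linarith
      moreover have "degree P * m + m \<le> K * m"
        using mult_le_mono1[of "Suc (degree P)" K m] deg by simp
      moreover have "K * m \<le> K * i + K * E"
        using mult_le_mono2[of m "i + E" K] False by (simp add: distrib_left)
      ultimately show ?thesis unfolding dpow_d by (intro a0) (use m in linarith)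
    qed
    then have "dpow (\<lambda>f. a f + d f) m (P ^ m * g) = 0"
      by (simp add: dpow_binomial[OF lin_a lin_d ad])
    moreover have "L = (\<lambda>f. a f + d f)" by (rule ext) (simp add: \<Lambda> a_def d_def)
    ultimately show ?thesis by (simp add: dpow_eq_0_iff)
  qed
  then show ?thesis by (intro exI[of _ "K * E + degree g + 1"]) auto
qed

theorem theorem3p1:
  fixes \<Phi> :: "complex poly" and P :: "complex poly poly"
  assumes "\<And>m::nat. m \<ge> 1 \<Longrightarrow> (Lambda_op \<Phi> ^^ m) (P ^ m) = 0"
  shows "\<forall>g :: complex poly poly. \<exists>N::nat. N \<ge> 1 \<and>
           (\<forall>m\<ge>N. (Lambda_op \<Phi> ^^ m) (P ^ m * g) = 0)"
proof
  fix g :: "complex poly poly"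
  obtain c0 c \<Phi>2 where \<Phi>: "\<Phi> = pCons c0 (pCons c \<Phi>2)"
    by (metis pCons_cases)
  have \<Lambda>P: "Lambda_op \<Phi> P = 0" using assms[of 1] by simp
  show "\<exists>N::nat. N \<ge> 1 \<and> (\<forall>m\<ge>N. (Lambda_op \<Phi> ^^ m) (P ^ m * g) = 0)"
  proof (cases "c0 = 0")
    case False
    then have "P = 0" using \<Lambda>P unfolding \<Phi> by (rule Lambda_op_eq_0D)
    have "(Lambda_op \<Phi> ^^ m) 0 = 0" for m
      by (induction m) (simp_all add: Lambda_op_def op_zero[OF op_linear_partial_x]
          op_zero[OF op_linear_subst_partial_y])
    \<comment> \<open>Starting at \<open>N = 1\<close> matters: \<open>0 ^ m\<close> vanishes only
      for positive \<open>m\<close>.\<close>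
    with \<open>P = 0\<close> show ?thesis by (intro exI[of _ 1]) (simp add: power_0_left)
  next
    case True
    define d where "d = dir_deriv 1 (- c)"
    have eq: "Lambda_op \<Phi> f = subst_partial_y (- \<Phi>2) (partial_y (partial_y f)) + d f" for f
      by (simp add: \<Phi> True Lambda_op_pCons_0 d_def)
    have dP: "d P = 0" using dir_deriv_eq_0 assms unfolding \<Phi> True d_def by blast
    have "\<exists>K \<Psi>. degree P < K \<and>
        (\<forall>f. subst_partial_y (- \<Phi>2) (partial_y (partial_y f)) = subst_partial_y \<Psi> ((partial_y ^^ K) f))"
    proof (cases "\<Phi>2 = 0")
      case True
      \<comment> \<open>The higher-order part is 0, so it counts as having any order; one above the
        degree of \<open>P\<close> suffices.\<close>
      then show ?thesis by (intro exI[of _ "Suc (degree P)"] exI[of _ 0]) simp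
    next
      case False
      then obtain k b \<Psi> where b: "b \<noteq> 0"
        and fac: "\<And>f. subst_partial_y (- \<Phi>2) f = subst_partial_y (pCons b \<Psi>) ((partial_y ^^ k) f)"
        using subst_partial_y_factor[of "- \<Phi>2"] by auto
      have fac2: "subst_partial_y (- \<Phi>2) (partial_y (partial_y f))
          = subst_partial_y (pCons b \<Psi>) ((partial_y ^^ (k + 2)) f)" for f
        by (simp add: fac funpow_swap1)
      \<comment> \<open>Subtracting \<open>d P = 0\<close> from \<Lambda> P = 0 leaves the
        higher-order part; its injective factor cancels, and \<open>k + 2\<close> derivatives in y
        annihilate \<open>P\<close>.\<close>
      have "subst_partial_y (pCons b \<Psi>) ((partial_y ^^ (k + 2)) P) = 0"
        using \<Lambda>P dP by (simp only: eq fac2 add_0_right)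
      then have "(partial_y ^^ (k + 2)) P = 0"
        by (rule subst_partial_y_eq_0D[OF b])
      then have "degree P < k + 2"
        unfolding partial_y_def[abs_def] funpow_pderiv_eq_0_iff by auto
      then show ?thesis using fac2 by blast
    qed
    then obtain K \<Psi> where "degree P < K"
      "\<And>f. Lambda_op \<Phi> f = subst_partial_y \<Psi> ((partial_y ^^ K) f) + dir_deriv 1 (- c) f"
      unfolding eq d_def by auto
    then show ?thesis using dP unfolding d_def by (intro eventually_vanishing)
  qed
qed

end
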